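(* Let $\mathcal{G}$ be a DAG with vertex set $V=\{1,\dots,p\}$ whose edges are consistent with the ordering $1<\dots<p$, let $A\subseteq V$, and let $\mathcal{G}^*$ be the corresponding augmented DAG. If the kernel $p(W_V\mid F_A)$ obeys distributional consistency and the augmented DAG local Markov property with respect to $\mathcal{G}^*$, then the observed distribution $p(W_V)$ obeys the usual (ordered) local Markov property with respect to $\mathcal{G}$; that is, for every $i\in V$, $W_i$ is conditionally independent of $W_{\mathrm{pre}(i)\setminus \mathrm{pa}(i)}$ given $W_{\mathrm{pa}(i)}$ under $p(W_V)$.
   Context: Variables are indexed by $V=\{1,\dots,p\}$ with discrete state spaces $\mathfrak{X}_i$; $\mathfrak{X}_D=\prod_{i\in D}\mathfrak{X}_i$ and $x_D$ is the restriction of an assignment $x$ to $D$. $A\subseteq V$ is the set of intervention targets. Each $i\in A$ has a non-stochastic regime indicator $F_i$ taking values in $\mathfrak{X}_i\cup\{\emptyset\}$, where $\emptyset$ ("idle") means no intervention. The kernel $p(W_V\mid F_A)$ assigns to each $f\in\prod_{i\in A}(\mathfrak{X}_i\cup\{\emptyset\})$ a probability distribution on $\mathfrak{X}_V$ for the random vector $W_V=(W_i)_{i\in V}$. Convention: regime indicators that are not mentioned are idle, so $p(\cdot\mid F_C=c)$ means $F_C=c$ and $F_{A\setminus C}=\emptyset$; the observed distribution $p(W_V)$ has all indicators idle. Conditional probabilities are considered when the conditioning event has positive probability, and an equality of conditional probabilities is asserted whenever both conditioning events have positive probability. Distributional consistency: for every $j\in A$, $C\subseteq A\setminus\{j\}$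 (possibly empty), $c\in\mathfrak{X}_C$ and $v\in\mathfrak{X}_V$: $p(W_V=v\mid F_j=v_j,F_C=c)=p(W_V=v\mid F_C=c)$. (Equivalently $W_V\perp F_j^*\mid F_C,\,F_C\neq\emptyset$, where $F_j^*\in\{\emptyset,g_j^*\}$ and $g_j^*$ is the dynamic regime that sets the target $j$ to its natural value $W_j$.) $\mathrm{pa}(i)$ is the set of parents of $i$ in $\mathcal{G}$ and $\mathrm{pre}(i)=\{1,\dots,i-1\}$. The augmented DAG $\mathcal{G}^*$ has vertex set $V\cup\{F_i: i\in A\}$, the edges of $\mathcal{G}$, and an edge $F_i\to j$ whenever $i\in A$ and $i\to j$ in $\mathcal{G}$. Augmented DAG local Markov property for $\mathcal{G}^*$: for all $i\in V$, $W_i\perp F_{A\setminus \mathrm{pa}(i)},\,W_{\mathrm{pre}(i)\setminus(\mathrm{pa}(i)\setminus A)}\mid W_{\mathrm{pa}(i)\setminus A},\,F_{A\cap \mathrm{pa}(i)},\,F_A\neq\emptyset$; i.e. for $a\in\mathfrak{X}_A$ (all indicators non-idle) and $w\in\mathfrak{X}_{\mathrm{pre}(i)}$, the conditional distribution $p(W_i\mid W_{\mathrm{pre}(i)}=w,F_A=a)$ is a function only of $a_{A\cap \mathrm{pa}(i)}$ and $w_{\mathrm{pa}(i)\setminus A}$ (over pairs $(a,w)$ for which it is defined). *)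

theory Defs
  imports "HOL-Probability.Probability" "Graph_Theory.Pair_Digraph"
begin

definition dag :: "'v pair_pre_digraph \<Rightarrow> bool" where
  "dag G \<longleftrightarrow> pair_digraph G \<and> acyclic (parcs G)"

definition parents :: "'v pair_pre_digraph \<Rightarrow> 'v \<Rightarrow> 'v set" where
  "parents G i = {j. (j, i) \<in> parcs G}"

datatype 'v aug_vertex = Var 'v | Regime 'v

definition augmented_dag ::
  "'v pair_pre_digraph \<Rightarrow> 'v set \<Rightarrow> 'v aug_vertex pair_pre_digraph" where
  "augmented_dag G A =
    \<lparr> pverts = Var ` pverts G \<union> Regime ` A,
      parcs = {(Var i, Var j) | i j. (i, j) \<in> parcs G}
            \<union> {(Regime i, Var j) | i j. i \<in> A \<and> (i, j) \<in> parcs G} \<rparr>"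

lemma parents_augmented_dag:
  "{j. Var j \<in> parents (augmented_dag G A) (Var i)} = parents G i"
  "{j. Regime j \<in> parents (augmented_dag G A) (Var i)} = A \<inter> parents G i"
  by (auto simp: parents_def augmented_dag_def)

text \<open>
  The state space of vertex \<open>i\<close> is a set \<open>X i\<close>; all of them are carved out of one type \<open>'s\<close>.
  An assignment to \<open>D\<close> is an element of \<open>Pi\<^sub>E D X\<close>, and \<open>x\<^sub>D\<close> is \<open>restrict x D\<close>.
  Distributions on discrete state spaces are probability mass functions.
  A value of \<open>F\<^sub>i\<close> is an option, with \<open>None\<close> for the idle regime.
\<close>

definition regimes :: "nat set \<Rightarrow> (nat \<Rightarrow> 's set) \<Rightarrow> (nat \<Rightarrow> 's option) set" where
  "regimes A X = Pi\<^sub>E A (\<lambda>i. insert None (Some ` X i))"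

definition regime_kernel ::
  "nat set \<Rightarrow> nat set \<Rightarrow> (nat \<Rightarrow> 's set) \<Rightarrow> ((nat \<Rightarrow> 's option) \<Rightarrow> (nat \<Rightarrow> 's) pmf) \<Rightarrow> bool" where
  "regime_kernel V A X K \<longleftrightarrow> (\<forall>f \<in> regimes A X. set_pmf (K f) \<subseteq> Pi\<^sub>E V X)"

text \<open>\<open>F\<^sub>C = c\<close>, all other indicators idle:\<close>

definition intervene :: "nat set \<Rightarrow> nat set \<Rightarrow> (nat \<Rightarrow> 's) \<Rightarrow> (nat \<Rightarrow> 's option)" where
  "intervene A C c = (\<lambda>i\<in>A. if i \<in> C then Some (c i) else None)"

definition idle :: "nat set \<Rightarrow> (nat \<Rightarrow> 's option)" where
  "idle A = (\<lambda>i\<in>A. None)"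

lemma intervene_empty: "intervene A {} c = idle A"
  by (simp add: intervene_def idle_def)

lemma intervene_in_regimes: "c \<in> Pi\<^sub>E C X \<Longrightarrow> intervene A C c \<in> regimes A X"
  by (auto simp: intervene_def regimes_def PiE_iff)

definition distributional_consistency ::
  "nat set \<Rightarrow> nat set \<Rightarrow> (nat \<Rightarrow> 's set) \<Rightarrow> ((nat \<Rightarrow> 's option) \<Rightarrow> (nat \<Rightarrow> 's) pmf) \<Rightarrow> bool" where
  "distributional_consistency V A X K \<longleftrightarrow>
    (\<forall>j \<in> A. \<forall>C \<subseteq> A - {j}. \<forall>c \<in> Pi\<^sub>E C X. \<forall>v \<in> Pi\<^sub>E V X.
       pmf (K (intervene A (insert j C) (c(j := v j)))) v = pmf (K (intervene A C c)) v)"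

definition pre :: "nat \<Rightarrow> nat set" where
  "pre i = {1..<i}"

text \<open>
  The law of \<open>W\<^sub>i\<close> given \<open>W\<^bsub>pre i\<^esub> = w\<close> under \<open>F\<^sub>A = a\<close> is a function \<open>g\<close> of the values of the
  regime parents and of the non-target random parents. Note that \<^const>\<open>cond_pmf\<close> is only
  meaningful when the conditioning event has positive probability.
\<close>

definition augmented_local_markov ::
  "nat set \<Rightarrow> nat set \<Rightarrow> (nat \<Rightarrow> 's set) \<Rightarrow> nat aug_vertex pair_pre_digraph
    \<Rightarrow> ((nat \<Rightarrow> 's option) \<Rightarrow> (nat \<Rightarrow> 's) pmf) \<Rightarrow> bool" where
  "augmented_local_markov V A X H K \<longleftrightarrow>
    (\<forall>i \<in> V. \<exists>g :: (nat \<Rightarrow> 's) \<Rightarrow> (nat \<Rightarrow> 's) \<Rightarrow> 's pmf.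
       \<forall>a \<in> Pi\<^sub>E A X. \<forall>w \<in> Pi\<^sub>E (pre i) X.
         measure_pmf.prob (K (intervene A A a)) {v. restrict v (pre i) = w} > 0 \<longrightarrow>
         map_pmf (\<lambda>v. v i) (cond_pmf (K (intervene A A a)) {v. restrict v (pre i) = w}) =
           g (restrict a {j. Regime j \<in> parents H (Var i)})
             (restrict w ({j. Var j \<in> parents H (Var i)} - A)))"

text \<open>
  \<open>Y\<close> and \<open>Y'\<close> are independent given \<open>Z\<close> under \<open>P\<close>. As \<open>Y\<close> and \<open>Y'\<close> may have different types,
  independence of their sigma-algebras is used: \<^term>\<open>range (vimage Y)\<close> is the sigma-algebra
  generated by \<open>Y\<close> when its values carry the discrete sigma-algebra.
\<close>

definition cond_indep_pmf ::
  "'w pmf \<Rightarrow> ('w \<Rightarrow> 'a) \<Rightarrow> ('w \<Rightarrow> 'b) \<Rightarrow> ('w \<Rightarrow> 'c) \<Rightarrow> bool" where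
  "cond_indep_pmf P Y Y' Z \<longleftrightarrow>
    (\<forall>z. measure_pmf.prob P {\<omega>. Z \<omega> = z} > 0 \<longrightarrow>
       prob_space.indep_set (measure_pmf (cond_pmf P {\<omega>. Z \<omega> = z}))
         (range (vimage Y)) (range (vimage Y')))"

definition local_markov :: "nat pair_pre_digraph \<Rightarrow> (nat \<Rightarrow> 's) pmf \<Rightarrow> bool" where
  "local_markov G P \<longleftrightarrow>
    (\<forall>i \<in> pverts G.
       cond_indep_pmf P (\<lambda>v. v i) (\<lambda>v. restrict v (pre i - parents G i))
         (\<lambda>v. restrict v (parents G i)))"

end

theory Submission
  imports Defs
begin

text \<open>
  Let \<open>P\<close> be the observed law and \<open>K\<^sub>a\<close> the law under \<open>F\<^sub>A = a\<close>. By the augmented Markov property,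
  the law of \<open>W\<^sub>1, \<dots>, W\<^sub>n\<close> under \<open>K\<^sub>a\<close> depends on \<open>a\<close> only through the targets before \<open>n\<close>. Iterated
  consistency gives \<open>P v = K\<^sub>a v\<close> for \<open>a = v\<^sub>A\<close>. Summing out the last variable, whose own regime
  is irrelevant to its law, shows by downward induction on \<open>n\<close> that \<open>P\<close> and \<open>K\<^sub>a\<close> agree on
  \<open>W\<^sub>1, \<dots>, W\<^sub>n = w\<close> as soon as \<open>a\<close> agrees with \<open>w\<close> on the targets before \<open>n\<close>. Hence the law of
  \<open>W\<^sub>i\<close> given its predecessors is the same under \<open>P\<close> and such a \<open>K\<^sub>a\<close>, where it is a function of
  the parents alone.
\<close>

section \<open>Fibrewise sums and conditional independence for probability mass functions\<close>

lemma prob_fibres_cong: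
  fixes P Q :: "'w pmf"
  assumes "\<And>w. w \<in> B \<Longrightarrow> measure_pmf.prob P {u. f u = w} = measure_pmf.prob Q {u. f u = w}"
  shows "measure_pmf.prob P {u. f u \<in> B} = measure_pmf.prob Q {u. f u \<in> B}"
proof -
  have *: "measure_pmf.prob M {u. f u \<in> B} = infsetsum (\<lambda>w. measure_pmf.prob M {u. f u = w}) B"
    for M :: "'w pmf"
    using measure_pmf_conv_infsetsum[of "map_pmf f M" B] by (simp add: pmf_map vimage_def)
  show ?thesis
    unfolding * using assms by (intro infsetsum_cong) auto
qed

text \<open>A factor common to all fibres over \<open>B\<close> comes out of the sum over
  \<open>B\<close>. Below, \<open>c\<close> is the conditional probability of an event for
  \<open>W_i\<close>, constant as long as the parents are held fixed.\<close>

lemma prob_fibres_Int: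
  assumes "\<And>w. w \<in> B \<Longrightarrow>
    measure_pmf.prob P ({u. f u = w} \<inter> E) = c * measure_pmf.prob P {u. f u = w}"
  shows "measure_pmf.prob P ({u. f u \<in> B} \<inter> E) = c * measure_pmf.prob P {u. f u \<in> B}"
proof -
  \<comment> \<open>Pairing \<open>f\<close> with the indicator of \<open>E\<close> turns the
    intersection into an event of a pushforward, whose probability is a sum of point masses.\<close>
  let ?M = "map_pmf (\<lambda>u. (f u, u \<in> E)) P"
  have "measure_pmf.prob P ({u. f u \<in> B} \<inter> E) = measure_pmf.prob ?M (B \<times> {True})"
    by (auto intro!: arg_cong2[where f = measure])
  also have "\<dots> = infsetsum (pmf ?M) (B \<times> {True})"
    by (rule measure_pmf_conv_infsetsum)
  also have "B \<times> {True} = (\<lambda>w. (w, True)) ` B"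
    by auto
  also have "infsetsum (pmf ?M) \<dots> = infsetsum (\<lambda>w. pmf ?M (w, True)) B"
    by (subst infsetsum_reindex) (auto simp: inj_on_def)
  also have "\<dots> = infsetsum (\<lambda>w. c * pmf (map_pmf f P) w) B"
  proof (rule infsetsum_cong)
    fix w assume "w \<in> B"
    have "(\<lambda>u. (f u, u \<in> E)) -` {(w, True)} = {u. f u = w} \<inter> E"
      by auto
    then show "pmf ?M (w, True) = c * pmf (map_pmf f P) w"
      using assms[OF \<open>w \<in> B\<close>] by (simp add: pmf_map vimage_def)
  qed simp
  also have "\<dots> = c * infsetsum (pmf (map_pmf f P)) B"
    by (rule infsetsum_cmult_right) (auto intro: pmf_abs_summable)
  also have "infsetsum (pmf (map_pmf f P)) B = measure_pmf.prob P {u. f u \<in> B}"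
    using measure_pmf_conv_infsetsum[of "map_pmf f P" B] by (simp add: vimage_def)
  finally show ?thesis .
qed

lemma measure_cond_pmf:
  assumes "measure_pmf.prob P C > 0"
  shows "measure_pmf.prob (cond_pmf P C) B = measure_pmf.prob P (C \<inter> B) / measure_pmf.prob P C"
proof -
  have "set_pmf P \<inter> C \<noteq> {}"
    using assms measure_pmf_zero_iff[of P C] by auto
  then show ?thesis
    using assms by (simp add: cond_pmf.rep_eq measure_pmf.emeasure_eq_measure)
qed

lemma prob_Int_eq_cond_pmf:
  assumes "measure_pmf.prob P C > 0"
  shows "measure_pmf.prob P (C \<inter> {u. f u \<in> S})
    = measure_pmf.prob P C * measure_pmf.prob (map_pmf f (cond_pmf P C)) S"
  using assms by (simp add: measure_cond_pmf vimage_def)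

text \<open>\<open>h z\<close> plays the conditional law of \<open>Y\<close> given
  \<open>Z = z\<close>. The premise is multiplied out, so null events for \<open>Y'\<close> need no
  separate treatment.\<close>

lemma cond_indep_pmfI:
  assumes "\<And>z S T. measure_pmf.prob P {u. Z u = z} > 0 \<Longrightarrow>
    measure_pmf.prob P ({u. Z u = z \<and> Y' u \<in> T} \<inter> {u. Y u \<in> S})
      = measure_pmf.prob (h z) S * measure_pmf.prob P {u. Z u = z \<and> Y' u \<in> T}"
  shows "cond_indep_pmf P Y Y' Z"
  unfolding cond_indep_pmf_def
proof (intro allI impI)
  fix z assume pos: "measure_pmf.prob P {u. Z u = z} > 0"
  let ?C = "{u. Z u = z}"
  let ?Q = "cond_pmf P ?C"
  have joint: "measure_pmf.prob ?Q (Y -` S \<inter> Y' -` T)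
      = measure_pmf.prob (h z) S * measure_pmf.prob ?Q (Y' -` T)" for S T
  proof -
    have "?C \<inter> (Y -` S \<inter> Y' -` T) = {u. Z u = z \<and> Y' u \<in> T} \<inter> {u. Y u \<in> S}"
      and "?C \<inter> Y' -` T = {u. Z u = z \<and> Y' u \<in> T}"
      by auto
    then show ?thesis
      unfolding measure_cond_pmf[OF pos] using assms[OF pos, of T S] by simp
  qed
  \<comment> \<open>Taking \<open>T = UNIV\<close> identifies \<open>h z\<close> as the law of
    \<open>Y\<close> under \<open>?Q\<close>, which makes \<open>joint\<close> the product
    rule.\<close>
  have marginal: "measure_pmf.prob ?Q (Y -` S) = measure_pmf.prob (h z) S" for S
    using joint[of S UNIV] measure_pmf.prob_space[of ?Q] by simp
  show "prob_space.indep_set ?Q (range (vimage Y)) (range (vimage Y'))"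
    by (auto simp: prob_space.indep_sets2_eq[OF prob_space_measure_pmf] joint marginal)
qed

section \<open>Prefixes of the vertex order and intervention regimes\<close>

lemma pre_Suc: "n \<ge> 1 \<Longrightarrow> pre (Suc n) = insert n (pre n)"
  by (auto simp: pre_def)

lemma restrict_pre_Suc_eq_iff:
  assumes "n \<ge> 1" and "w \<in> extensional (pre (Suc n))"
  shows "restrict u (pre (Suc n)) = w \<longleftrightarrow> restrict u (pre n) = restrict w (pre n) \<and> u n = w n"
  using assms by (auto simp: pre_Suc fun_eq_iff extensional_def)

lemma intervene_cong: "(\<And>j. j \<in> C \<Longrightarrow> c j = d j) \<Longrightarrow> intervene A C c = intervene A C d"
  by (auto simp: intervene_def)

lemma idle_in_regimes: "idle A \<in> regimes A X"
  by (auto simp: idle_def regimes_def)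

section \<open>The observed law and the fully intervened laws\<close>

locale regime_model =
  fixes p :: nat and G :: "nat pair_pre_digraph" and A :: "nat set" and X :: "nat \<Rightarrow> 's set"
    and K :: "(nat \<Rightarrow> 's option) \<Rightarrow> (nat \<Rightarrow> 's) pmf"
  assumes dag: "dag G" and verts: "pverts G = {1..p}"
    and ordered: "\<And>i j. (i, j) \<in> parcs G \<Longrightarrow> i < j"
    and targets: "A \<subseteq> {1..p}"
    and kernel: "regime_kernel {1..p} A X K"
    and consistent: "distributional_consistency {1..p} A X K"
    and markov: "augmented_local_markov {1..p} A X (augmented_dag G A) K"
begin

abbreviation observed :: "(nat \<Rightarrow> 's) pmf" where
  "observed \<equiv> K (idle A)"

abbreviation forced :: "(nat \<Rightarrow> 's) \<Rightarrow> (nat \<Rightarrow> 's) pmf" where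
  "forced a \<equiv> K (intervene A A a)"

abbreviation past :: "nat \<Rightarrow> (nat \<Rightarrow> 's) \<Rightarrow> (nat \<Rightarrow> 's) set" where
  "past n w \<equiv> {v. restrict v (pre n) = w}"

lemma parents_subset_pre: "parents G i \<subseteq> pre i"
proof
  fix j assume "j \<in> parents G i"
  then have arc: "(j, i) \<in> parcs G"
    by (simp add: parents_def)
  \<comment> \<open>The ordering yields only \<open>j < i\<close>; the bound
    \<open>1 \<le> j\<close>, needed for \<open>pre i\<close>, comes from arcs ending in
    vertices.\<close>
  interpret pair_digraph G
    using dag by (simp add: dag_def)
  have "j \<in> pverts G"
    using arc by (rule in_arcsD1)
  then show "j \<in> pre i"
    using ordered[OF arc] verts by (simp add: pre_def)
qed

lemma pre_subset: "i \<le> Suc p \<Longrightarrow> pre i \<subseteq> {1..p}"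
  by (auto simp: pre_def)

lemma set_observed: "set_pmf observed \<subseteq> Pi\<^sub>E {1..p} X"
  using kernel idle_in_regimes unfolding regime_kernel_def by blast

lemma set_forced: "a \<in> Pi\<^sub>E A X \<Longrightarrow> set_pmf (forced a) \<subseteq> Pi\<^sub>E {1..p} X"
  using kernel intervene_in_regimes unfolding regime_kernel_def by blast

text \<open>A probability mass function has nonempty support. The assignment found here later
  supplies values for targets that do not precede \<open>i\<close>.\<close>

lemma states_nonempty: "\<exists>x. x \<in> Pi\<^sub>E {1..p} X"
  using set_observed set_pmf_not_empty[of observed] by auto

text \<open>The targets in \<open>C\<close> are switched on one at a time, each forced to the value
  it takes in \<open>v\<close>; consistency keeps the mass of \<open>v\<close> unchanged at every
  switch.\<close>

lemma pmf_intervene_self: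
  assumes v: "v \<in> Pi\<^sub>E {1..p} X" and "C \<subseteq> A"
  shows "pmf (K (intervene A C v)) v = pmf observed v"
proof -
  have "finite C"
    using \<open>C \<subseteq> A\<close> targets by (meson finite_atLeastAtMost finite_subset)
  then show ?thesis
    using \<open>C \<subseteq> A\<close>
  proof (induction C)
    case empty
    then show ?case by (simp add: intervene_empty)
  next
    case (insert j C)
    have "restrict v C \<in> Pi\<^sub>E C X"
      using v insert.prems targets by (auto simp: PiE_iff)
    then have "pmf (K (intervene A (insert j C) ((restrict v C)(j := v j)))) v
        = pmf (K (intervene A C (restrict v C))) v"
      using consistent insert v unfolding distributional_consistency_def by blast
    moreover have "intervene A (insert j C) ((restrict v C)(j := v j)) = intervene A (insert j C) v"
      and "intervene A C (restrict v C) = intervene A C v"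
      by (auto intro: intervene_cong)
    ultimately show ?case
      using insert by simp
  qed
qed

text \<open>In product form the Markov property needs no positivity assumption: on a null past both
  sides vanish.\<close>

lemma markov_kernel:
  assumes "i \<in> {1..p}"
  obtains g :: "(nat \<Rightarrow> 's) \<Rightarrow> (nat \<Rightarrow> 's) \<Rightarrow> 's pmf" where
    "\<And>a w S. a \<in> Pi\<^sub>E A X \<Longrightarrow> w \<in> Pi\<^sub>E (pre i) X \<Longrightarrow>
      measure_pmf.prob (forced a) (past i w \<inter> {v. v i \<in> S})
        = measure_pmf.prob (forced a) (past i w)
          * measure_pmf.prob (g (restrict a (A \<inter> parents G i)) (restrict w (parents G i - A))) S"
proof -
  obtain g :: "(nat \<Rightarrow> 's) \<Rightarrow> (nat \<Rightarrow> 's) \<Rightarrow> 's pmf" where g: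
    "\<And>a w. a \<in> Pi\<^sub>E A X \<Longrightarrow> w \<in> Pi\<^sub>E (pre i) X \<Longrightarrow> measure_pmf.prob (forced a) (past i w) > 0 \<Longrightarrow>
      map_pmf (\<lambda>v. v i) (cond_pmf (forced a) (past i w))
        = g (restrict a (A \<inter> parents G i)) (restrict w (parents G i - A))"
    using markov assms unfolding augmented_local_markov_def parents_augmented_dag by metis
  show thesis
  proof (rule that)
    fix a w S assume aw: "a \<in> Pi\<^sub>E A X" "w \<in> Pi\<^sub>E (pre i) X"
    let ?h = "g (restrict a (A \<inter> parents G i)) (restrict w (parents G i - A))"
    show "measure_pmf.prob (forced a) (past i w \<inter> {v. v i \<in> S})
        = measure_pmf.prob (forced a) (past i w) * measure_pmf.prob ?h S"
    proof (cases "measure_pmf.prob (forced a) (past i w) > 0")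
      case True
      then show ?thesis
        using prob_Int_eq_cond_pmf[OF True, of "\<lambda>v. v i" S] g[OF aw True] by simp
    next
      case False
      then have "measure_pmf.prob (forced a) (past i w) = 0"
        using measure_nonneg[of "forced a" "past i w"] by linarith
      moreover have "measure_pmf.prob (forced a) (past i w \<inter> {v. v i \<in> S})
          \<le> measure_pmf.prob (forced a) (past i w)"
        by (rule measure_pmf.finite_measure_mono) auto
      ultimately show ?thesis
        using measure_nonneg[of "forced a" "past i w \<inter> {v. v i \<in> S}"] by simp
    qed
  qed
qed

lemma prob_forced_cong:
  assumes "n \<le> p" and "a \<in> Pi\<^sub>E A X" and "b \<in> Pi\<^sub>E A X" and "w \<in> Pi\<^sub>E (pre (Suc n)) X"
    and "\<And>j. j \<in> A \<inter> pre n \<Longrightarrow> a j = b j"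
  shows "measure_pmf.prob (forced a) (past (Suc n) w) = measure_pmf.prob (forced b) (past (Suc n) w)"
  using assms
proof (induction n arbitrary: w)
  case 0
  have "past (Suc 0) w = UNIV"
    using "0.prems"(4) by (auto simp: pre_def)
  then show ?case
    using measure_pmf.prob_space[of "forced a"] measure_pmf.prob_space[of "forced b"]
    by (simp only: space_measure_pmf)
next
  case (Suc n)
  let ?i = "Suc n"
  let ?w = "restrict w (pre ?i)"
  obtain g :: "(nat \<Rightarrow> 's) \<Rightarrow> (nat \<Rightarrow> 's) \<Rightarrow> 's pmf" where g:
    "\<And>a w S. a \<in> Pi\<^sub>E A X \<Longrightarrow> w \<in> Pi\<^sub>E (pre ?i) X \<Longrightarrow>
      measure_pmf.prob (forced a) (past ?i w \<inter> {v. v ?i \<in> S})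
        = measure_pmf.prob (forced a) (past ?i w)
          * measure_pmf.prob (g (restrict a (A \<inter> parents G ?i)) (restrict w (parents G ?i - A))) S"
    using markov_kernel[of ?i] Suc.prems(1) by auto
  have w: "?w \<in> Pi\<^sub>E (pre ?i) X"
    using Suc.prems(4) by (auto simp: PiE_iff pre_def)
  have split: "past (Suc ?i) w = past ?i ?w \<inter> {v. v ?i \<in> {w ?i}}"
    using restrict_pre_Suc_eq_iff[of ?i w] Suc.prems(4) by (auto simp: PiE_def)
  have "measure_pmf.prob (forced a) (past ?i ?w) = measure_pmf.prob (forced b) (past ?i ?w)"
    using Suc.prems w by (intro Suc.IH) (auto simp: pre_def)
  moreover have "restrict a (A \<inter> parents G ?i) = restrict b (A \<inter> parents G ?i)"
    using Suc.prems(5) parents_subset_pre by (intro restrict_ext) auto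
  ultimately show ?case
    unfolding split by (simp only: g[OF _ w] Suc.prems(2,3))
qed

lemma prob_observed_eq_forced:
  assumes "n \<le> p" and "w \<in> Pi\<^sub>E (pre (Suc n)) X" and "a \<in> Pi\<^sub>E A X"
    and "\<And>j. j \<in> A \<inter> pre n \<Longrightarrow> a j = w j"
  shows "measure_pmf.prob observed (past (Suc n) w) = measure_pmf.prob (forced a) (past (Suc n) w)"
  using assms
proof (induction arbitrary: w a rule: inc_induct)
  case base
  have V: "pre (Suc p) = {1..p}"
    by (auto simp: pre_def)
  let ?a = "restrict w A"
  have w: "w \<in> Pi\<^sub>E {1..p} X"
    using base V by simp
  then have a: "?a \<in> Pi\<^sub>E A X"
    using targets by (auto simp: PiE_iff)
  have point: "measure_pmf.prob M (past (Suc p) w) = pmf M w"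
    if "set_pmf M \<subseteq> Pi\<^sub>E {1..p} X" for M
  proof -
    \<comment> \<open>The event also contains assignments that differ from \<open>w\<close> outside
      \<open>{1..p}\<close>; the support excludes them.\<close>
    have "restrict u {1..p} = u" if "u \<in> set_pmf M" for u
      using that \<open>set_pmf M \<subseteq> _\<close> by (auto intro: PiE_restrict)
    then have "measure_pmf.prob M (past (Suc p) w) = measure_pmf.prob M {w}"
      unfolding V by (intro measure_prob_cong_0) (auto simp: pmf_eq_0_set_pmf PiE_restrict[OF w])
    then show ?thesis
      by (simp add: pmf.rep_eq)
  qed
  have "measure_pmf.prob observed (past (Suc p) w) = pmf (forced w) w"
    using pmf_intervene_self[OF w order_refl] point[OF set_observed] by simp
  also have "forced w = forced ?a"
    by (simp cong: intervene_cong)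
  also have "pmf (forced ?a) w = measure_pmf.prob (forced ?a) (past (Suc p) w)"
    using point[OF set_forced[OF a]] by simp
  \<comment> \<open>\<open>a\<close> and \<open>?a\<close> may differ at the target
    \<open>p\<close>, whose regime has no effect on \<open>W_1, ..., W_p\<close>.\<close>
  also have "\<dots> = measure_pmf.prob (forced a) (past (Suc p) w)"
    using base a by (intro prob_forced_cong) auto
  finally show ?case .
next
  case (step n)
  let ?i = "Suc n"
  \<comment> \<open>\<open>a\<close> may disagree with \<open>w\<close> at \<open>n\<close>, where
    the induction hypothesis requires agreement. \<open>?b\<close> repairs this, and one
    \<open>?b\<close> serves every extension \<open>u\<close> of \<open>w\<close> in
    \<open>?B\<close>, since the value at \<open>?i\<close> is not constrained.\<close>
  let ?b = "\<lambda>j\<in>A. if j \<in> pre ?i then w j else a j"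
  let ?B = "{u \<in> Pi\<^sub>E (pre (Suc ?i)) X. restrict u (pre ?i) = w}"
  have b: "?b \<in> Pi\<^sub>E A X"
    using step.prems by (auto simp: PiE_iff)
  have sum_out: "measure_pmf.prob M (past ?i w)
      = measure_pmf.prob M {v. restrict v (pre (Suc ?i)) \<in> ?B}"
    if "set_pmf M \<subseteq> Pi\<^sub>E {1..p} X" for M
  proof (rule measure_prob_cong_0)
    fix v assume "v \<in> past ?i w - {v. restrict v (pre (Suc ?i)) \<in> ?B}"
    moreover have "pre ?i \<subseteq> pre (Suc ?i)"
      by (auto simp: pre_def)
    ultimately have "restrict v (pre (Suc ?i)) \<notin> Pi\<^sub>E (pre (Suc ?i)) X"
      by (auto simp: restrict_restrict inf.absorb2)
    then have "v \<notin> Pi\<^sub>E {1..p} X"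
      using step.hyps pre_subset[of "Suc ?i"] by (auto simp: PiE_iff)
    then show "pmf M v = 0"
      using that by (auto simp: pmf_eq_0_set_pmf)
  next
    fix v assume "v \<in> {v. restrict v (pre (Suc ?i)) \<in> ?B} - past ?i w"
    moreover have "pre ?i \<subseteq> pre (Suc ?i)"
      by (auto simp: pre_def)
    ultimately show "pmf M v = 0"
      by (auto simp: restrict_restrict inf.absorb2)
  qed
  have "measure_pmf.prob observed (past ?i w)
      = measure_pmf.prob observed {v. restrict v (pre (Suc ?i)) \<in> ?B}"
    by (rule sum_out[OF set_observed])
  also have "\<dots> = measure_pmf.prob (forced ?b) {v. restrict v (pre (Suc ?i)) \<in> ?B}"
  proof (rule prob_fibres_cong)
    fix u assume "u \<in> ?B"
    then have "u \<in> Pi\<^sub>E (pre (Suc ?i)) X" and w: "\<And>j. j \<in> pre ?i \<Longrightarrow> w j = u j"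
      by auto
    then show "measure_pmf.prob observed (past (Suc ?i) u) = measure_pmf.prob (forced ?b) (past (Suc ?i) u)"
      by (intro step.IH[OF _ b]) (simp_all add: w)
  qed
  also have "\<dots> = measure_pmf.prob (forced ?b) (past ?i w)"
    by (rule sum_out[OF set_forced[OF b], symmetric])
  also have "\<dots> = measure_pmf.prob (forced a) (past ?i w)"
    using step b by (intro prob_forced_cong) (auto simp: pre_def)
  finally show ?case .
qed

text \<open>The event is, up to null sets, a union of pasts of length \<open>i\<close>. Comparing
  these needs agreement of \<open>a\<close> only before \<open>i\<close>, so a single
  \<open>a\<close> works for all values of \<open>W_i\<close> in \<open>S\<close>.\<close>

lemma prob_observed_past_Int:
  assumes i: "i \<in> {1..p}" and w: "w \<in> Pi\<^sub>E (pre i) X" and a: "a \<in> Pi\<^sub>E A X"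
    and aw: "\<And>j. j \<in> A \<inter> pre i \<Longrightarrow> a j = w j"
  shows "measure_pmf.prob observed (past i w \<inter> {v. v i \<in> S})
    = measure_pmf.prob (forced a) (past i w \<inter> {v. v i \<in> S})"
proof -
  let ?B = "{u \<in> Pi\<^sub>E (pre (Suc i)) X. restrict u (pre i) = w \<and> u i \<in> S}"
  have pre: "pre i \<subseteq> pre (Suc i)" "i \<in> pre (Suc i)"
    using i by (auto simp: pre_def)
  have *: "measure_pmf.prob M (past i w \<inter> {v. v i \<in> S})
      = measure_pmf.prob M {v. restrict v (pre (Suc i)) \<in> ?B}"
    if "set_pmf M \<subseteq> Pi\<^sub>E {1..p} X" for M
  proof (rule measure_prob_cong_0)
    fix v assume "v \<in> past i w \<inter> {v. v i \<in> S} - {v. restrict v (pre (Suc i)) \<in> ?B}"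
    then have "restrict v (pre (Suc i)) \<notin> Pi\<^sub>E (pre (Suc i)) X"
      using pre by (auto simp: restrict_restrict inf.absorb2)
    then have "v \<notin> Pi\<^sub>E {1..p} X"
      using i pre_subset[of "Suc i"] by (auto simp: PiE_iff)
    then show "pmf M v = 0"
      using that by (auto simp: pmf_eq_0_set_pmf)
  next
    fix v assume "v \<in> {v. restrict v (pre (Suc i)) \<in> ?B} - past i w \<inter> {v. v i \<in> S}"
    then show "pmf M v = 0"
      using pre by (auto simp: restrict_restrict inf.absorb2)
  qed
  show ?thesis
    unfolding *[OF set_observed] *[OF set_forced[OF a]]
    by (rule prob_fibres_cong, rule prob_observed_eq_forced) (use i a aw in auto)
qed

lemma observed_factorises:
  assumes i: "i \<in> {1..p}"
  obtains h :: "(nat \<Rightarrow> 's) \<Rightarrow> 's pmf" where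
    "\<And>w S. measure_pmf.prob observed (past i w \<inter> {v. v i \<in> S})
      = measure_pmf.prob (h (restrict w (parents G i))) S * measure_pmf.prob observed (past i w)"
proof -
  obtain g :: "(nat \<Rightarrow> 's) \<Rightarrow> (nat \<Rightarrow> 's) \<Rightarrow> 's pmf" where g:
    "\<And>a w S. a \<in> Pi\<^sub>E A X \<Longrightarrow> w \<in> Pi\<^sub>E (pre i) X \<Longrightarrow>
      measure_pmf.prob (forced a) (past i w \<inter> {v. v i \<in> S})
        = measure_pmf.prob (forced a) (past i w)
          * measure_pmf.prob (g (restrict a (A \<inter> parents G i)) (restrict w (parents G i - A))) S"
    using markov_kernel[OF i] by auto
  \<comment> \<open>A target parent enters \<open>g\<close> through its regime, another parent
    through its random value; under the observed law both are read off the parent values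
    \<open>z\<close>.\<close>
  define h where "h z = g (restrict z (A \<inter> parents G i)) (restrict z (parents G i - A))" for z
  show thesis
  proof (rule that)
    fix w :: "nat \<Rightarrow> 's" and S
    show "measure_pmf.prob observed (past i w \<inter> {v. v i \<in> S})
      = measure_pmf.prob (h (restrict w (parents G i))) S * measure_pmf.prob observed (past i w)"
    proof (cases "w \<in> Pi\<^sub>E (pre i) X")
      case True
      obtain x where x: "x \<in> Pi\<^sub>E {1..p} X"
        using states_nonempty by blast
      \<comment> \<open>Copying \<open>w\<close> before \<open>i\<close> makes the forced values of
        the target parents equal to their observed ones; \<open>x\<close> is mere filler.\<close>
      define a where "a = (\<lambda>j\<in>A. if j \<in> pre i then w j else x j)"
      have a: "a \<in> Pi\<^sub>E A X"
        using True x targets by (auto simp: a_def PiE_iff)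
      have aw: "a j = w j" if "j \<in> A \<inter> pre i" for j
        using that by (simp add: a_def)
      have "restrict a (A \<inter> parents G i) = restrict w (A \<inter> parents G i)"
        using aw parents_subset_pre by (intro restrict_ext) auto
      then have "h (restrict w (parents G i))
          = g (restrict a (A \<inter> parents G i)) (restrict w (parents G i - A))"
        by (simp add: h_def restrict_restrict Int_absorb1 Int_commute Int_Diff)
      \<comment> \<open>The instance \<open>UNIV\<close> equates the probabilities of the past
        itself, so the factorisation transfers from \<open>forced a\<close> to
        \<open>observed\<close>.\<close>
      then show ?thesis
        using prob_observed_past_Int[OF i True a aw, of S] g[OF a True, of S]
          prob_observed_past_Int[OF i True a aw, of UNIV]
        by simp
    next
      case False
      have "restrict v (pre i) \<in> Pi\<^sub>E (pre i) X" if "v \<in> set_pmf observed" for v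
        using that set_observed pre_subset[of i] i by (auto simp: PiE_iff)
      then have "set_pmf observed \<inter> past i w = {}"
        using False by blast
      then have "measure_pmf.prob observed (past i w) = 0"
        and "measure_pmf.prob observed (past i w \<inter> {v. v i \<in> S}) = 0"
        unfolding measure_pmf_zero_iff by blast+
      then show ?thesis
        by simp
    qed
  qed
qed

lemma local_markov_observed: "local_markov G observed"
  unfolding local_markov_def
proof
  fix i assume "i \<in> pverts G"
  then have i: "i \<in> {1..p}"
    by (simp add: verts)
  obtain h :: "(nat \<Rightarrow> 's) \<Rightarrow> 's pmf" where h:
    "\<And>w S. measure_pmf.prob observed (past i w \<inter> {v. v i \<in> S})
      = measure_pmf.prob (h (restrict w (parents G i))) S * measure_pmf.prob observed (past i w)"
    using observed_factorises[OF i] by auto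
  show "cond_indep_pmf observed (\<lambda>v. v i) (\<lambda>v. restrict v (pre i - parents G i))
      (\<lambda>v. restrict v (parents G i))"
  proof (rule cond_indep_pmfI)
    fix z :: "nat \<Rightarrow> 's" and S and T :: "(nat \<Rightarrow> 's) set"
    let ?B = "{w. restrict w (parents G i) = z \<and> restrict w (pre i - parents G i) \<in> T}"
    \<comment> \<open>As parents precede \<open>i\<close>, the conditioning event is a union of
      pasts. All of them share the parent values \<open>z\<close>, hence the factor
      \<open>h z\<close>.\<close>
    have "pre i \<inter> parents G i = parents G i"
      and "pre i \<inter> (pre i - parents G i) = pre i - parents G i"
      using parents_subset_pre[of i] by auto
    then have eq: "{u. restrict u (parents G i) = z \<and> restrict u (pre i - parents G i) \<in> T}
        = {u. restrict u (pre i) \<in> ?B}"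
      by simp
    have "measure_pmf.prob observed ({u. restrict u (pre i) \<in> ?B} \<inter> {u. u i \<in> S})
        = measure_pmf.prob (h z) S * measure_pmf.prob observed {u. restrict u (pre i) \<in> ?B}"
      by (rule prob_fibres_Int) (simp add: h)
    then show "measure_pmf.prob observed
          ({u. restrict u (parents G i) = z \<and> restrict u (pre i - parents G i) \<in> T} \<inter> {u. u i \<in> S})
        = measure_pmf.prob (h z) S * measure_pmf.prob observed
          {u. restrict u (parents G i) = z \<and> restrict u (pre i - parents G i) \<in> T}"
      unfolding eq[symmetric] .
  qed
qed

end

theorem theorem20:
  fixes p :: nat
    and G :: "nat pair_pre_digraph"
    and A :: "nat set"
    and X :: "nat \<Rightarrow> 's set"
    and K :: "(nat \<Rightarrow> 's option) \<Rightarrow> (nat \<Rightarrow> 's) pmf"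
  assumes "dag G" and "pverts G = {1..p}"
    and "\<And>i j. (i, j) \<in> parcs G \<Longrightarrow> i < j"
    and "A \<subseteq> {1..p}"
    and "regime_kernel {1..p} A X K"
    and "distributional_consistency {1..p} A X K"
    and "augmented_local_markov {1..p} A X (augmented_dag G A) K"
  shows "local_markov G (K (idle A))"
proof -
  interpret regime_model p G A X K
    using assms by unfold_locales
  show ?thesis
    by (rule local_markov_observed)
qed

end
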